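(* Let $f:\mathbb R^d\to\mathbb R$ be convex and $(\delta_f,L_f)$-approximately smooth with components $(\bar f,\bar g)$, and let $\hat g$ be an unbiased stochastic oracle for $\bar g$. Consider the (AdaGrad) stepsize update rule $\hat M_+=M_+(M,\Omega,x,\hat x_+,\hat g_x,\hat g_{x_+})$ defined by $$\hat M_+:=\sqrt{M^2+\frac1\Omega\|\hat g_{x_+}-\hat g_x\|_*^2}.$$ Then this rule satisfies the requirement (R) of the context with $c_1=\frac52$, $c_2=4$, $c_3=6$, $c_4=2$; that is, $\hat M_+\ge M$ and, for any $\bar M>4L_f$, $$\mathbb E[\hat\Delta(\hat M_+)+(\hat M_+-M)\Omega+\beta(\hat x_+,x)]\le\frac{5}{2(\bar M-4L_f)}\mathbb E[\mathrm{Var}_{\hat g}(\hat x_+)+\mathrm{Var}_{\hat g}(x)]+6\delta_f+2\,\mathbb E\{[\min\{\hat M_+,\bar M\}-M]_+\Omega\}.$$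
   Context: Space: $\mathbb R^d$ with standard inner product $\langle\cdot,\cdot\rangle$, norm $\|x\|=\langle Bx,x\rangle^{1/2}$ ($B$ a fixed positive definite matrix), dual norm $\|s\|_*=\max_{\|x\|=1}\langle s,x\rangle=\langle s,B^{-1}s\rangle^{1/2}$. $[t]_+=\max\{t,0\}$. $\psi:\mathbb R^d\to\mathbb R\cup\{+\infty\}$ is a proper closed convex function, $\operatorname{dom}\psi=\{x:\psi(x)<+\infty\}$. Approximate smoothness: $f$ is $(\delta_f,L_f)$-approximately smooth ($\delta_f,L_f\ge0$) with components $\bar f:\mathbb R^d\to\mathbb R$, $\bar g:\mathbb R^d\to\mathbb R^d$ if $\beta(x,y):=f(y)-\bar f(x)-\langle\bar g(x),y-x\rangle$ satisfies $0\le\beta(x,y)\le\frac{L_f}{2}\|x-y\|^2+\delta_f$ for all $x,y\in\mathbb R^d$. Stochastic oracle: $\hat g=(g,\xi)$ is a random variable $\xi$ with a mapping $g$; a query at $x$ generates an independent copy of $\xi$ and returns $g(x,\xi)$. It is unbiased for $\bar g$ if $\mathbb E_\xi[g(x,\xi)]=\bar g(x)$ for all $x$. $\mathrm{Var}_{\hat g}(x)=\mathbb E_\xi[\|g(x,\xi)-\bar g(x)\|_*^2]$. Requirement (R) on a stepsize update rule $M_+(\cdot)$, with (absolute) constants $c_1,\dots,c_4>0$: given the current stepsize coefficient $M\ge0$, a constant $\Omega>0$, the current point $x\in\operatorname{dom}\psi$ with the stochastic gradient $\hat g_x$ (the output of a query of $\hat g$ at $x$), and the next random point $\hat x_+\in\operatorname{dom}\psi$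 (possibly dependent on $\hat g_x$) with the stochastic gradient $\hat g_{x_+}$ (the output of a query of $\hat g$ at $\hat x_+$), the rule computes $\hat M_+=M_+(M,\Omega,x,\hat x_+,\hat g_x,\hat g_{x_+})$ such that $\hat M_+\ge M$ and, for any $\bar M>c_2L_f$, $$\mathbb E[\hat\Delta(\hat M_+)+(\hat M_+-M)\Omega+\beta(\hat x_+,x)]\le\frac{c_1}{\bar M-c_2L_f}\mathbb E[\mathrm{Var}_{\hat g}(\hat x_+)+\mathrm{Var}_{\hat g}(x)]+c_3\delta_f+c_4\mathbb E\{[\min\{\hat M_+,\bar M\}-M]_+\Omega\},$$ where $\hat\Delta(\hat M_+)=\beta(x,\hat x_+)+\langle\bar g(x)-\hat g_x,\hat x_+-x\rangle-\frac{\hat M_+}{2}\|\hat x_+-x\|^2$ and the expectation is taken with respect to the entire randomness. *)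

theory Defs
  imports "HOL-Probability.Probability"
begin

definition pos_def_mat :: "real^'n^'n \<Rightarrow> bool" where
  "pos_def_mat B \<longleftrightarrow> transpose B = B \<and> (\<forall>x. x \<noteq> 0 \<longrightarrow> (B *v x) \<bullet> x > 0)"

definition mnorm :: "real^'n^'n \<Rightarrow> real^'n \<Rightarrow> real" where
  "mnorm B x = sqrt ((B *v x) \<bullet> x)"

(* For positive definite B the unit sphere is compact and non-empty,
   so the supremum is a maximum. *)
definition dual_mnorm :: "real^'n^'n \<Rightarrow> real^'n \<Rightarrow> real" where
  "dual_mnorm B s = (SUP x\<in>{x. mnorm B x = 1}. s \<bullet> x)"

definition eff_domain :: "('a \<Rightarrow> ereal) \<Rightarrow> 'a set" where
  "eff_domain \<psi> = {x. \<psi> x < \<infinity>}"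

(* Convexity and closedness are expressed through the epigraph, as a subset of
   the product of the space with the real line. *)
definition proper_closed_convex :: "('a::real_normed_vector \<Rightarrow> ereal) \<Rightarrow> bool" where
  "proper_closed_convex \<psi> \<longleftrightarrow>
     (\<forall>x. \<psi> x \<noteq> -\<infinity>) \<and> eff_domain \<psi> \<noteq> {} \<and>
     convex {(x, t::real). \<psi> x \<le> ereal t} \<and>
     closed {(x, t::real). \<psi> x \<le> ereal t}"

definition lin_err ::
  "(real^'n \<Rightarrow> real) \<Rightarrow> (real^'n \<Rightarrow> real) \<Rightarrow> (real^'n \<Rightarrow> real^'n) \<Rightarrow> real^'n \<Rightarrow> real^'n \<Rightarrow> real" where
  "lin_err f fbar gbar x y = f y - fbar x - gbar x \<bullet> (y - x)"

definition approx_smooth ::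
  "real^'n^'n \<Rightarrow> real \<Rightarrow> real \<Rightarrow> (real^'n \<Rightarrow> real) \<Rightarrow> (real^'n \<Rightarrow> real) \<Rightarrow>
   (real^'n \<Rightarrow> real^'n) \<Rightarrow> bool" where
  "approx_smooth B \<delta> L f fbar gbar \<longleftrightarrow> \<delta> \<ge> 0 \<and> L \<ge> 0 \<and>
     (\<forall>x y. 0 \<le> lin_err f fbar gbar x y \<and>
            lin_err f fbar gbar x y \<le> L / 2 * (mnorm B (x - y))\<^sup>2 + \<delta>)"

(* D is the law of the oracle's random variable.  Joint measurability is what makes
   the answer to a query at a random point a random vector. *)
definition stoch_oracle :: "'s measure \<Rightarrow> (real^'n \<Rightarrow> 's \<Rightarrow> real^'n) \<Rightarrow> bool" where
  "stoch_oracle D g \<longleftrightarrow> prob_space D \<and> case_prod g \<in> borel_measurable (borel \<Otimes>\<^sub>M D)"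

definition unbiased_oracle ::
  "'s measure \<Rightarrow> (real^'n \<Rightarrow> 's \<Rightarrow> real^'n) \<Rightarrow> (real^'n \<Rightarrow> real^'n) \<Rightarrow> bool" where
  "unbiased_oracle D g gbar \<longleftrightarrow> (\<forall>x. has_bochner_integral D (g x) (gbar x))"

(* Extended-valued: a finite variance is not part of the assumptions. *)
definition oracle_var ::
  "real^'n^'n \<Rightarrow> 's measure \<Rightarrow> (real^'n \<Rightarrow> 's \<Rightarrow> real^'n) \<Rightarrow> (real^'n \<Rightarrow> real^'n) \<Rightarrow>
   real^'n \<Rightarrow> ennreal" where
  "oracle_var B D g gbar x = (\<integral>\<^sup>+s. ennreal ((dual_mnorm B (g x s - gbar x))\<^sup>2) \<partial>D)"

(* The expectation of X exists, possibly as an infinite value: the positive and the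
   negative part do not both have infinite expectation. *)
definition has_ext_expectation :: "'w measure \<Rightarrow> ('w \<Rightarrow> real) \<Rightarrow> bool" where
  "has_ext_expectation P X \<longleftrightarrow> X \<in> borel_measurable P \<and>
     ((\<integral>\<^sup>+w. ennreal (X w) \<partial>P) < \<infinity> \<or> (\<integral>\<^sup>+w. ennreal (- X w) \<partial>P) < \<infinity>)"

(* ennreal truncates negative reals to 0, so the two integrals are those of the
   positive and of the negative part of X. *)
definition ext_expectation :: "'w measure \<Rightarrow> ('w \<Rightarrow> real) \<Rightarrow> ereal" where
  "ext_expectation P X =
     enn2ereal (\<integral>\<^sup>+w. ennreal (X w) \<partial>P) - enn2ereal (\<integral>\<^sup>+w. ennreal (- X w) \<partial>P)"

(* The library's indep_var requires both variables to have the same value type;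
   independence of the generated sigma-algebras does not. *)
definition indep_rvs ::
  "'w measure \<Rightarrow> 'a measure \<Rightarrow> ('w \<Rightarrow> 'a) \<Rightarrow> 'b measure \<Rightarrow> ('w \<Rightarrow> 'b) \<Rightarrow> bool" where
  "indep_rvs P N X K Y \<longleftrightarrow> X \<in> measurable P N \<and> Y \<in> measurable P K \<and>
     prob_space.indep_set P (sets (vimage_algebra (space P) X N))
                            (sets (vimage_algebra (space P) Y K))"

(* xi and xi' drive the queries at the current point and at the next random point xp.
   The point xp may depend arbitrarily on xi, whereas xi' is a fresh copy,
   independent of everything generated before the second query. *)
definition oracle_queries ::
  "'w measure \<Rightarrow> 's measure \<Rightarrow> ('w \<Rightarrow> 's) \<Rightarrow> ('w \<Rightarrow> real^'n) \<Rightarrow> ('w \<Rightarrow> 's) \<Rightarrow> bool" where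
  "oracle_queries P D xi xp xi' \<longleftrightarrow>
     xi \<in> measurable P D \<and> distr P D xi = D \<and>
     xp \<in> borel_measurable P \<and>
     xi' \<in> measurable P D \<and> distr P D xi' = D \<and>
     indep_rvs P (D \<Otimes>\<^sub>M borel) (\<lambda>w. (xi w, xp w)) D xi'"

(* Argument order of a rule:
   current coefficient, Omega, current point, next point, gradients at these points. *)
type_synonym 'n stepsize_rule =
  "real \<Rightarrow> real \<Rightarrow> real^'n \<Rightarrow> real^'n \<Rightarrow> real^'n \<Rightarrow> real^'n \<Rightarrow> real"

definition progress_gap ::
  "real^'n^'n \<Rightarrow> (real^'n \<Rightarrow> real) \<Rightarrow> (real^'n \<Rightarrow> real) \<Rightarrow> (real^'n \<Rightarrow> real^'n) \<Rightarrow>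
   real^'n \<Rightarrow> real^'n \<Rightarrow> real^'n \<Rightarrow> real \<Rightarrow> real" where
  "progress_gap B f fbar gbar x xp gx Mp =
     lin_err f fbar gbar x xp + (gbar x - gx) \<bullet> (xp - x) - Mp / 2 * (mnorm B (xp - x))\<^sup>2"

(* The current coefficient M and the current point x are deterministic.  The summands on
   the right are expectations of nonnegative quantities; the expectation on the left
   is only spoken of when it exists. *)
definition stepsize_requirement ::
  "real^'n^'n \<Rightarrow> (real^'n \<Rightarrow> ereal) \<Rightarrow> real \<Rightarrow> real \<Rightarrow>
   (real^'n \<Rightarrow> real) \<Rightarrow> (real^'n \<Rightarrow> real) \<Rightarrow> (real^'n \<Rightarrow> real^'n) \<Rightarrow>
   's measure \<Rightarrow> (real^'n \<Rightarrow> 's \<Rightarrow> real^'n) \<Rightarrow> 'w measure \<Rightarrow>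
   'n stepsize_rule \<Rightarrow> real \<Rightarrow> real \<Rightarrow> real \<Rightarrow> real \<Rightarrow> bool" where
  "stepsize_requirement B \<psi> \<delta> L f fbar gbar D g P rule c1 c2 c3 c4 \<longleftrightarrow>
     c1 > 0 \<and> c2 > 0 \<and> c3 > 0 \<and> c4 > 0 \<and>
     (\<forall>M \<Omega> x xi xp xi'.
        M \<ge> 0 \<and> \<Omega> > 0 \<and> x \<in> eff_domain \<psi> \<and>
        oracle_queries P D xi xp xi' \<and> (AE w in P. xp w \<in> eff_domain \<psi>) \<longrightarrow>
        (let Mp = (\<lambda>w. rule M \<Omega> x (xp w) (g x (xi w)) (g (xp w) (xi' w)));
             lhs = (\<lambda>w. progress_gap B f fbar gbar x (xp w) (g x (xi w)) (Mp w)
                        + (Mp w - M) * \<Omega> + lin_err f fbar gbar (xp w) x)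
         in Mp \<in> borel_measurable P \<and>
            (\<forall>w\<in>space P. Mp w \<ge> M) \<and>
            (\<forall>Mbar. Mbar > c2 * L \<and> has_ext_expectation P lhs \<longrightarrow>
               ext_expectation P lhs \<le>
                 ereal (c1 / (Mbar - c2 * L)) *
                   enn2ereal (\<integral>\<^sup>+w. oracle_var B D g gbar (xp w) + oracle_var B D g gbar x \<partial>P)
                 + ereal (c3 * \<delta>)
                 + ereal c4 *
                   enn2ereal (\<integral>\<^sup>+w. ennreal (max (min (Mp w) Mbar - M) 0 * \<Omega>) \<partial>P))))"

definition adagrad_rule :: "real^'n^'n \<Rightarrow> 'n stepsize_rule" where
  "adagrad_rule B M \<Omega> x xp gx gxp = sqrt (M\<^sup>2 + 1 / \<Omega> * (dual_mnorm B (gxp - gx))\<^sup>2)"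

end

theory Submission
  imports Defs
begin

text \<open>Write \<open>y\<close> for the next point, \<open>u\<close> and \<open>v\<close> for the stochastic gradients at \<open>x\<close> and \<open>y\<close>, and
  \<open>A\<close> for the threshold \<open>Mbar\<close>. Adding \<open>N = (v - gbar y) \<bullet> (y - x)\<close>, which has conditional mean zero
  because the second query is independent of \<open>y\<close>, makes the inequality hold pointwise.
  If \<open>Mp \<le> A\<close>, the two linearisation errors combine to \<open>(gbar y - gbar x) \<bullet> (y - x) + 2 * \<delta>\<close>, and
  Young's inequality for \<open>(v - u) \<bullet> (y - x)\<close> leaves at most another
  \<open>(Mp - M) * \<Omega>\<close>. If \<open>Mp > A\<close>, the increment beyond \<open>A\<close> is at most \<open>\<parallel>v - u\<parallel>\<^sup>2 / (2 * A)\<close>;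
  here \<open>v - u\<close> is the noise plus \<open>gbar y - gbar x\<close>, and the square of the latter is at most \<open>A / 4\<close>
  times the linearisation errors, which the term \<open>- A / 2 * \<parallel>y - x\<parallel>\<^sup>2\<close> absorbs.\<close>

section \<open>The norm induced by a positive definite matrix and its dual\<close>

lemma pos_def_mat_inner_commute:
  fixes B :: "real^'n^'n"
  assumes "pos_def_mat B"
  shows "(B *v x) \<bullet> y = (B *v y) \<bullet> x"
proof -
  have "B *v x = x v* B"
    using assms by (metis pos_def_mat_def transpose_matrix_vector)
  then show ?thesis
    by (metis dot_lmul_matrix inner_commute)
qed

lemma pos_def_mat_nonneg:
  fixes B :: "real^'n^'n"
  assumes "pos_def_mat B"
  shows "(B *v x) \<bullet> x \<ge> 0"
  using assms by (cases "x = 0") (auto simp: pos_def_mat_def intro: less_imp_le)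

lemma pos_def_mat_Cauchy_Schwarz:
  fixes B :: "real^'n^'n"
  assumes B: "pos_def_mat B"
  shows "((B *v x) \<bullet> y)\<^sup>2 \<le> ((B *v x) \<bullet> x) * ((B *v y) \<bullet> y)"
proof (cases "y = 0")
  case False
  define p where "p = (B *v y) \<bullet> y"
  \<comment> \<open>\<open>t\<close> minimises the quadratic form along
    \<open>x - t *\<^sub>R y\<close>, so nonnegativity there is the sharpest and yields the
    claim.\<close>
  define t where "t = (B *v x) \<bullet> y / p"
  have p: "p > 0"
    using B False by (auto simp: pos_def_mat_def p_def)
  have "0 \<le> (B *v (x - t *\<^sub>R y)) \<bullet> (x - t *\<^sub>R y)"
    by (rule pos_def_mat_nonneg[OF B])
  also have "\<dots> = (B *v x) \<bullet> x - 2 * t * ((B *v x) \<bullet> y) + t\<^sup>2 * p"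
    by (simp add: p_def matrix_vector_mult_diff_distrib matrix_vector_mult_scaleR
        inner_diff_left inner_diff_right pos_def_mat_inner_commute[OF B, of y x]
        power2_eq_square algebra_simps)
  also have "\<dots> = (B *v x) \<bullet> x - ((B *v x) \<bullet> y)\<^sup>2 / p"
    using p by (simp add: t_def power2_eq_square field_simps)
  finally show ?thesis
    using p by (simp add: p_def field_simps)
qed simp

lemma mnorm_nonneg: "pos_def_mat B \<Longrightarrow> mnorm B x \<ge> 0"
  by (simp add: mnorm_def pos_def_mat_nonneg)

lemma mnorm_power2: "pos_def_mat B \<Longrightarrow> (mnorm B x)\<^sup>2 = (B *v x) \<bullet> x"
  by (simp add: mnorm_def pos_def_mat_nonneg)

lemma mnorm_scaleR: "mnorm B (c *\<^sub>R x) = \<bar>c\<bar> * mnorm B x"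
  by (simp add: mnorm_def matrix_vector_mult_scaleR real_sqrt_mult flip: mult.assoc)

lemma mnorm_eq_0_iff: "pos_def_mat B \<Longrightarrow> mnorm B x = 0 \<longleftrightarrow> x = 0"
  by (auto simp: mnorm_def pos_def_mat_def)

lemma inner_le_mnorm_mult:
  assumes "pos_def_mat B"
  shows "(B *v x) \<bullet> y \<le> mnorm B x * mnorm B y"
  unfolding mnorm_def real_sqrt_mult[symmetric]
  using pos_def_mat_Cauchy_Schwarz[OF assms, of x y] by (rule real_le_rsqrt)

lemma mnorm_triangle:
  assumes B: "pos_def_mat B"
  shows "mnorm B (x + y) \<le> mnorm B x + mnorm B y"
proof (rule power2_le_imp_le)
  show "(mnorm B (x + y))\<^sup>2 \<le> (mnorm B x + mnorm B y)\<^sup>2"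
    using inner_le_mnorm_mult[OF B, of x y]
    by (simp add: power2_sum mnorm_power2[OF B] matrix_vector_right_distrib inner_add_left
        inner_add_right pos_def_mat_inner_commute[OF B, of y x])
qed (simp add: mnorm_nonneg[OF B])

lemma continuous_on_mnorm: "continuous_on S (mnorm B)"
  unfolding mnorm_def by (intro continuous_intros)

lemma pos_def_mat_invertible:
  fixes B :: "real^'n^'n"
  assumes "pos_def_mat B"
  shows "invertible B"
proof -
  have "x = 0" if "B *v x = 0" for x
    using assms that by (force simp: pos_def_mat_def)
  then show ?thesis
    by (simp add: invertible_left_inverse matrix_left_invertible_ker)
qed

lemma pos_def_mat_mult_inv:
  fixes B :: "real^'n^'n"
  assumes "pos_def_mat B"
  shows "B *v (matrix_inv B *v s) = s"
proof -
  have "B ** matrix_inv B = mat 1"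
    using someI_ex[OF pos_def_mat_invertible[OF assms, unfolded invertible_def]]
    by (simp add: matrix_inv_def)
  then show ?thesis
    by (simp add: matrix_vector_mul_assoc)
qed

text \<open>Cauchy-Schwarz for the form of \<open>B\<close> bounds the supremum, and the normalised
  \<open>q\<close> attains it. Since \<open>B\<close> is invertible, every vector has the form
  \<open>B *v q\<close>.\<close>

lemma dual_mnorm_mult:
  fixes B :: "real^'n^'n"
  assumes B: "pos_def_mat B"
  shows "dual_mnorm B (B *v q) = mnorm B q"
  unfolding dual_mnorm_def
proof (rule cSup_eq_maximum)
  \<comment> \<open>For \<open>q = 0\<close> any nonzero vector serves: it only has to show that the
    unit sphere is nonempty, so that the value 0 is attained.\<close>
  define e :: "real^'n" where "e = (if q = 0 then axis undefined 1 else q)"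
  have e: "mnorm B e > 0"
    using mnorm_eq_0_iff[OF B, of e] mnorm_nonneg[OF B, of e] by (auto simp: e_def)
  have "mnorm B ((1 / mnorm B e) *\<^sub>R e) = 1"
    using e by (simp only: mnorm_scaleR) simp
  moreover have "(B *v q) \<bullet> ((1 / mnorm B e) *\<^sub>R e) = mnorm B q"
    using e mnorm_power2[OF B, of q]
    by (auto simp: e_def mnorm_def real_div_sqrt split: if_splits)
  ultimately show "mnorm B q \<in> (\<bullet>) (B *v q) ` {x. mnorm B x = 1}"
    by (metis (mono_tags, lifting) image_eqI mem_Collect_eq)
next
  fix t assume "t \<in> (\<bullet>) (B *v q) ` {x. mnorm B x = 1}"
  then obtain x where "mnorm B x = 1" "t = (B *v q) \<bullet> x"
    by blast
  then show "t \<le> mnorm B q"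
    using inner_le_mnorm_mult[OF B, of q x] by simp
qed

text \<open>Replaces the supremum by a norm composed with a linear map, so that the triangle
  inequality, symmetry and measurability of the dual norm come from \<open>mnorm\<close>.\<close>

lemma dual_mnorm_eq:
  assumes "pos_def_mat B"
  shows "dual_mnorm B s = mnorm B (matrix_inv B *v s)"
  using dual_mnorm_mult[OF assms, of "matrix_inv B *v s"] by (simp add: pos_def_mat_mult_inv[OF assms])

lemma dual_mnorm_nonneg: "pos_def_mat B \<Longrightarrow> dual_mnorm B s \<ge> 0"
  by (simp add: dual_mnorm_eq mnorm_nonneg)

lemma dual_mnorm_triangle:
  "pos_def_mat B \<Longrightarrow> dual_mnorm B (s + t) \<le> dual_mnorm B s + dual_mnorm B t"
  by (simp add: dual_mnorm_eq matrix_vector_right_distrib mnorm_triangle)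

lemma dual_mnorm_minus:
  assumes "pos_def_mat B"
  shows "dual_mnorm B (- s) = dual_mnorm B s"
proof -
  have "matrix_inv B *v (- s) = (-1) *\<^sub>R (matrix_inv B *v s)"
    by (simp flip: matrix_vector_mult_scaleR)
  then show ?thesis
    using mnorm_scaleR[of B "-1" "matrix_inv B *v s"] by (simp add: dual_mnorm_eq[OF assms])
qed

lemma inner_le_dual_mnorm:
  "pos_def_mat B \<Longrightarrow> s \<bullet> x \<le> dual_mnorm B s * mnorm B x"
  by (metis dual_mnorm_eq inner_le_mnorm_mult pos_def_mat_mult_inv)

lemma borel_measurable_dual_mnorm [measurable]:
  assumes "pos_def_mat B"
  shows "dual_mnorm B \<in> borel_measurable borel"
proof -
  have "continuous_on UNIV (\<lambda>s. mnorm B (matrix_inv B *v s))"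
    using continuous_on_compose[OF matrix_vector_mult_linear_continuous_on continuous_on_mnorm]
    by (simp add: o_def)
  then show ?thesis
    unfolding dual_mnorm_eq[OF assms, abs_def] by (rule borel_measurable_continuous_onI)
qed

section \<open>Young-type inequalities\<close>

lemma young_dual_mnorm:
  assumes B: "pos_def_mat B" and "c > 0"
  shows "s \<bullet> d - c / 2 * (mnorm B d)\<^sup>2 \<le> (dual_mnorm B s)\<^sup>2 / (2 * c)"
proof -
  have "0 \<le> (dual_mnorm B s - c * mnorm B d)\<^sup>2 / (2 * c)"
    using \<open>c > 0\<close> by simp
  also have "\<dots> = (dual_mnorm B s)\<^sup>2 / (2 * c) - dual_mnorm B s * mnorm B d + c / 2 * (mnorm B d)\<^sup>2"
    using \<open>c > 0\<close> by (simp add: field_simps power2_eq_square)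
  finally show ?thesis
    using inner_le_dual_mnorm[OF B, of s d] by simp
qed

text \<open>The weight stays free because two values are used: \<open>1 / 2\<close> to separate the
  noise from the gradient difference, and \<open>1\<close> to separate the errors of the two
  queries.\<close>

lemma dual_mnorm_add_power2_le:
  assumes B: "pos_def_mat B" and "t > 0"
  shows "(dual_mnorm B (a + b))\<^sup>2 \<le> (1 + t) * (dual_mnorm B a)\<^sup>2 + (1 + 1 / t) * (dual_mnorm B b)\<^sup>2"
proof -
  have "(dual_mnorm B (a + b))\<^sup>2 \<le> (dual_mnorm B a + dual_mnorm B b)\<^sup>2"
    by (intro power_mono dual_mnorm_triangle dual_mnorm_nonneg B)
  also have "\<dots> \<le> \<dots> + (t * dual_mnorm B a - dual_mnorm B b)\<^sup>2 / t"
    using \<open>t > 0\<close> by simp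
  also have "\<dots> = (1 + t) * (dual_mnorm B a)\<^sup>2 + (1 + 1 / t) * (dual_mnorm B b)\<^sup>2"
    using \<open>t > 0\<close> by (simp add: field_simps power2_eq_square)
  finally show ?thesis .
qed

section \<open>Consequences of approximate smoothness\<close>

text \<open>The affine minorant at \<open>x\<close> lies below the quadratic majorant at \<open>y\<close>; the minimiser of
  the difference is \<open>y + v\<close>.\<close>

lemma approx_smooth_gradient_diff:
  assumes B: "pos_def_mat B" and "approx_smooth B \<delta> L f fbar gbar" and "c > 0" "L \<le> c"
  shows "(dual_mnorm B (gbar y - gbar x))\<^sup>2 \<le> 2 * c * (lin_err f fbar gbar x y + \<delta>)"
proof -
  note sm = assms(2)[unfolded approx_smooth_def]
  define s where "s = gbar y - gbar x"
  define q where "q = matrix_inv B *v s"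
  \<comment> \<open>Any \<open>c\<close> above \<open>L\<close> still gives a quadratic majorant,
    and a positive \<open>c\<close> permits the division when \<open>L = 0\<close>.\<close>
  define v where "v = (- 1 / c) *\<^sub>R q"
  have q: "s \<bullet> q = (dual_mnorm B s)\<^sup>2" "mnorm B q = dual_mnorm B s"
    using mnorm_power2[OF B, of q] pos_def_mat_mult_inv[OF B, of s]
    by (simp_all add: q_def dual_mnorm_eq[OF B])
  have v: "s \<bullet> v = - (dual_mnorm B s)\<^sup>2 / c" "(mnorm B (- v))\<^sup>2 = (dual_mnorm B s)\<^sup>2 / c\<^sup>2"
    using \<open>c > 0\<close> mnorm_scaleR[of B "1 / c" q] by (simp_all add: v_def q power_divide)
  have "0 \<le> lin_err f fbar gbar x (y + v)"
    using sm by blast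
  also have "\<dots> = lin_err f fbar gbar y (y + v) + (fbar y - f y) + lin_err f fbar gbar x y + s \<bullet> v"
    by (simp add: lin_err_def s_def inner_diff_left inner_diff_right inner_add_right)
  also have "\<dots> \<le> (L / 2 * (mnorm B (- v))\<^sup>2 + \<delta>) + 0 + lin_err f fbar gbar x y + s \<bullet> v"
  proof -
    have "lin_err f fbar gbar y (y + v) \<le> L / 2 * (mnorm B (y - (y + v)))\<^sup>2 + \<delta>"
      using sm by blast
    moreover have "0 \<le> lin_err f fbar gbar y y"
      using sm by blast
    ultimately show ?thesis
      by (simp add: lin_err_def)
  qed
  also have "L / 2 * (mnorm B (- v))\<^sup>2 \<le> c / 2 * (mnorm B (- v))\<^sup>2"
    using \<open>L \<le> c\<close> by (intro mult_right_mono) auto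
  also have "c / 2 * (mnorm B (- v))\<^sup>2 + \<delta> + 0 + lin_err f fbar gbar x y + s \<bullet> v
      = lin_err f fbar gbar x y + \<delta> - (dual_mnorm B s)\<^sup>2 / (2 * c)"
    unfolding v using \<open>c > 0\<close> by (simp add: power2_eq_square field_simps)
  finally show ?thesis
    using \<open>c > 0\<close> by (simp add: s_def field_simps)
qed

text \<open>The two sides differ only through the gaps \<open>f - fbar\<close> at \<open>x\<close>
  and at \<open>y\<close>. Each gap is a linearisation error on the diagonal, where the quadratic
  term vanishes.\<close>

lemma lin_err_symmetrized:
  assumes "approx_smooth B \<delta> L f fbar gbar"
  shows "lin_err f fbar gbar x y + lin_err f fbar gbar y x \<le> (gbar y - gbar x) \<bullet> (y - x) + 2 * \<delta>"
proof -
  have "lin_err f fbar gbar z z \<le> L / 2 * (mnorm B (z - z))\<^sup>2 + \<delta>" for z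
    using assms unfolding approx_smooth_def by blast
  then have "lin_err f fbar gbar z z \<le> \<delta>" for z
    by (simp add: mnorm_def)
  from this[of x] this[of y] show ?thesis
    by (simp add: lin_err_def inner_diff_left inner_diff_right)
qed

section \<open>Pointwise bounds for one AdaGrad step\<close>

lemma adagrad_rule_ge:
  assumes "M \<ge> 0" "\<Omega> > 0"
  shows "M \<le> adagrad_rule B M \<Omega> x y u v"
  unfolding adagrad_rule_def using assms by (intro real_le_rsqrt) simp

lemma adagrad_rule_power2:
  assumes "\<Omega> > 0"
  shows "((adagrad_rule B M \<Omega> x y u v)\<^sup>2 - M\<^sup>2) * \<Omega> = (dual_mnorm B (v - u))\<^sup>2"
  using assms by (simp add: adagrad_rule_def)

text \<open>After symmetrisation the mean gradients cancel against the added noise, leaving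
  \<open>(v - u) \<bullet> (y - x)\<close>. Young's inequality with weight \<open>Mp\<close> then
  meets the identity that defines the rule.\<close>

lemma adagrad_step_bound_small:
  fixes B :: "real^'n^'n" and M \<Omega> :: real and x y u v :: "real^'n"
  defines "Mp \<equiv> adagrad_rule B M \<Omega> x y u v"
  assumes B: "pos_def_mat B" and sm: "approx_smooth B \<delta> L f fbar gbar"
    and M: "M \<ge> 0" and \<Omega>: "\<Omega> > 0"
  shows "progress_gap B f fbar gbar x y u Mp + (Mp - M) * \<Omega> + lin_err f fbar gbar y x
      + (v - gbar y) \<bullet> (y - x) \<le> 2 * \<delta> + 2 * ((Mp - M) * \<Omega>)"
proof -
  define G where "G = dual_mnorm B (v - u)"
  have Mp: "M \<le> Mp" and sq: "(Mp\<^sup>2 - M\<^sup>2) * \<Omega> = G\<^sup>2"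
    unfolding Mp_def G_def by (rule adagrad_rule_ge[OF M \<Omega>] adagrad_rule_power2[OF \<Omega>])+
  have "(v - u) \<bullet> (y - x) - Mp / 2 * (mnorm B (y - x))\<^sup>2 \<le> (Mp - M) * \<Omega>"
  \<comment> \<open>Young's inequality divides by \<open>Mp\<close>. If \<open>Mp\<close> vanishes,
    the two stochastic gradients have dual distance 0 and the inner product is at most 0.\<close>
  proof (cases "Mp = 0")
    case True
    then have "G = 0" using sq M Mp by simp
    then show ?thesis
      using inner_le_dual_mnorm[OF B, of "v - u" "y - x"] True Mp M by (simp add: G_def)
  next
    case False
    then have pos: "Mp > 0" using M Mp by simp
    have "(v - u) \<bullet> (y - x) - Mp / 2 * (mnorm B (y - x))\<^sup>2 \<le> G\<^sup>2 / (2 * Mp)"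
      unfolding G_def by (rule young_dual_mnorm[OF B pos])
    also have "\<dots> \<le> (Mp - M) * \<Omega>"
    proof -
      have "G\<^sup>2 = (Mp - M) * \<Omega> * (Mp + M)"
        using sq by (simp add: power2_eq_square algebra_simps)
      also have "\<dots> \<le> (Mp - M) * \<Omega> * (2 * Mp)"
        using Mp \<Omega> by (intro mult_left_mono) auto
      finally show ?thesis
        using pos by (simp add: field_simps)
    qed
    finally show ?thesis .
  qed
  with lin_err_symmetrized[OF sm, of x y] show ?thesis
    by (simp add: progress_gap_def inner_diff_left algebra_simps)
qed

lemma adagrad_step_bound_large:
  fixes B :: "real^'n^'n" and M \<Omega> :: real and x y u v :: "real^'n"
  defines "Mp \<equiv> adagrad_rule B M \<Omega> x y u v"
  assumes B: "pos_def_mat B" and sm: "approx_smooth B \<delta> L f fbar gbar"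
    and M: "M \<ge> 0" and \<Omega>: "\<Omega> > 0" and A: "A > 4 * L" and MpA: "Mp > A"
  shows "progress_gap B f fbar gbar x y u Mp + (Mp - M) * \<Omega> + lin_err f fbar gbar y x
      + (v - gbar y) \<bullet> (y - x)
      \<le> 5 / 4 * ((dual_mnorm B ((v - gbar y) + (gbar x - u)))\<^sup>2 / (A - 4 * L)) + 6 * \<delta>
        + max (A - M) 0 * \<Omega>"
proof -
  define G where "G = dual_mnorm B (v - u)"
  define \<sigma> where "\<sigma> = (v - gbar y) + (gbar x - u)"
  define S where "S = lin_err f fbar gbar x y + lin_err f fbar gbar y x"
  define r where "r = mnorm B (y - x)"
  define n where "n = dual_mnorm B \<sigma>"
  \<comment> \<open>The increment of the coefficient is split at \<open>m\<close>: the part from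
    \<open>M\<close> to \<open>m\<close> becomes the capped term, and only the part from
    \<open>m\<close> to \<open>Mp\<close> needs a bound.\<close>
  define m where "m = max A M"
  define k where "k = n\<^sup>2 / (A - 4 * L)"
  have L: "L \<ge> 0" and \<delta>: "\<delta> \<ge> 0"
    using sm by (auto simp: approx_smooth_def)
  have Apos: "A > 0" using A L by simp
  have Mp: "M \<le> Mp" and sq: "(Mp\<^sup>2 - M\<^sup>2) * \<Omega> = G\<^sup>2"
    unfolding Mp_def G_def by (rule adagrad_rule_ge[OF M \<Omega>] adagrad_rule_power2[OF \<Omega>])+
  have S_le: "S \<le> L * r\<^sup>2 + 2 * \<delta>"
  proof -
    have "mnorm B (x - y) = r"
      using mnorm_scaleR[of B "-1" "y - x"] by (simp add: r_def)
    moreover have "lin_err f fbar gbar a b \<le> L / 2 * (mnorm B (a - b))\<^sup>2 + \<delta>" for a b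
      using sm by (auto simp: approx_smooth_def)
    from this[of x y] this[of y x] calculation show ?thesis
      by (auto simp: S_def r_def)
  qed
  have grad: "(dual_mnorm B (gbar y - gbar x))\<^sup>2 \<le> A / 4 * (S + 2 * \<delta>)"
  proof -
    \<comment> \<open>The weight \<open>A / 4\<close> is admissible because
      \<open>A > 4 * L\<close>; this is the source of the threshold. Averaging the two orders of the
      points brings in the symmetric sum \<open>S\<close>.\<close>
    have "(dual_mnorm B (gbar y - gbar x))\<^sup>2 \<le> 2 * (A / 4) * (lin_err f fbar gbar x y + \<delta>)"
      "(dual_mnorm B (gbar x - gbar y))\<^sup>2 \<le> 2 * (A / 4) * (lin_err f fbar gbar y x + \<delta>)"
      using A Apos by (intro approx_smooth_gradient_diff[OF B sm]; simp)+
    moreover have "dual_mnorm B (gbar x - gbar y) = dual_mnorm B (gbar y - gbar x)"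
      using dual_mnorm_minus[OF B, of "gbar y - gbar x"] by simp
    ultimately show ?thesis
      by (simp add: S_def algebra_simps)
  qed
  have "v - u = \<sigma> + (gbar y - gbar x)"
    by (simp add: \<sigma>_def)
  then have "G\<^sup>2 \<le> (1 + 1 / 2) * n\<^sup>2 + (1 + 1 / (1 / 2)) * (dual_mnorm B (gbar y - gbar x))\<^sup>2"
    unfolding G_def n_def by (simp only:) (rule dual_mnorm_add_power2_le[OF B]; simp)
  with grad have G: "G\<^sup>2 \<le> 3 / 2 * n\<^sup>2 + 3 / 4 * A * (S + 2 * \<delta>)"
    by simp
  \<comment> \<open>Both \<open>Mp\<close> and \<open>m\<close> are at least \<open>A\<close>, so
    the difference of squares controls \<open>Mp - m\<close> with the factor
    \<open>2 * A\<close>.\<close>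
  have "(Mp - m) * \<Omega> * (2 * A) \<le> (Mp - m) * \<Omega> * (Mp + m)"
    using MpA Mp \<Omega> by (intro mult_left_mono) (auto simp: m_def)
  also have "\<dots> = (Mp\<^sup>2 - m\<^sup>2) * \<Omega>"
    by (simp add: power2_eq_square algebra_simps)
  also have "\<dots> \<le> (Mp\<^sup>2 - M\<^sup>2) * \<Omega>"
    using M \<Omega> by (intro mult_right_mono) (auto simp: m_def intro: power_mono)
  finally have "(Mp - m) * \<Omega> * (2 * A) \<le> 3 / 2 * n\<^sup>2 + 3 / 4 * A * (S + 2 * \<delta>)"
    using sq G by linarith
  then have growth: "(Mp - m) * \<Omega> \<le> 3 / 4 * (n\<^sup>2 / A) + 3 / 8 * (S + 2 * \<delta>)"
    using Apos by (simp add: field_simps)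
  \<comment> \<open>\<open>S\<close> will occur with total coefficient
    \<open>1 + 3 / 8 = 11 / 8\<close>, so \<open>11 / 8 * L * r\<^sup>2\<close> is held back from
    \<open>A / 2 * r\<^sup>2\<close> to absorb it. The remaining weight exceeds
    \<open>A - 4 * L\<close>.\<close>
  have "\<sigma> \<bullet> (y - x) - (A - 11 / 4 * L) / 2 * r\<^sup>2 \<le> n\<^sup>2 / (2 * (A - 11 / 4 * L))"
    unfolding r_def n_def using A L by (intro young_dual_mnorm[OF B]) linarith
  also have "\<dots> \<le> n\<^sup>2 / (2 * (A - 4 * L))"
    using A L by (intro divide_left_mono mult_pos_pos) auto
  also have "\<dots> = k / 2"
    by (simp add: k_def)
  finally have young: "\<sigma> \<bullet> (y - x) - (A - 11 / 4 * L) / 2 * r\<^sup>2 \<le> k / 2" .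
  have noise: "n\<^sup>2 / A \<le> k"
    unfolding k_def using A L Apos by (intro divide_left_mono mult_pos_pos) auto
  have quad: "A / 2 * r\<^sup>2 \<le> Mp / 2 * r\<^sup>2"
    using MpA by (intro mult_right_mono) auto
  have "(Mp - M) * \<Omega> = (Mp - m) * \<Omega> + max (A - M) 0 * \<Omega>"
    by (simp add: m_def max_def algebra_simps)
  then have "progress_gap B f fbar gbar x y u Mp + (Mp - M) * \<Omega> + lin_err f fbar gbar y x
      + (v - gbar y) \<bullet> (y - x)
      = S + \<sigma> \<bullet> (y - x) - Mp / 2 * r\<^sup>2 + (Mp - m) * \<Omega> + max (A - M) 0 * \<Omega>"
    by (simp add: progress_gap_def S_def \<sigma>_def r_def inner_add_left inner_diff_left)
  also have "\<dots> \<le> S + (k / 2 - 11 / 8 * (L * r\<^sup>2))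
      + (3 / 4 * k + 3 / 8 * (S + 2 * \<delta>)) + max (A - M) 0 * \<Omega>"
  proof -
    have "(A - 11 / 4 * L) / 2 * r\<^sup>2 = A / 2 * r\<^sup>2 - 11 / 8 * (L * r\<^sup>2)"
      by (simp add: algebra_simps diff_divide_distrib)
    with young growth noise quad show ?thesis
      by linarith
  qed
  also have "\<dots> \<le> 5 / 4 * k + 6 * \<delta> + max (A - M) 0 * \<Omega>"
  proof -
    \<comment> \<open>The terms in \<open>L * r\<^sup>2\<close> cancel. The noise adds up to
      \<open>1 / 2 + 3 / 4 = 5 / 4\<close>, and the offsets to \<open>7 / 2 * \<delta>\<close>,
      below \<open>6 * \<delta>\<close>.\<close>
    have "S + (k / 2 - 11 / 8 * (L * r\<^sup>2)) + (3 / 4 * k + 3 / 8 * (S + 2 * \<delta>)) \<le> 5 / 4 * k + 6 * \<delta>"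
      using S_le \<delta> by (simp add: field_simps)
    then show ?thesis
      by (rule add_right_mono)
  qed
  finally show ?thesis
    by (simp only: k_def n_def \<sigma>_def)
qed

text \<open>When \<open>Mp\<close> is at most \<open>A\<close>, the minimum is \<open>Mp\<close>
  itself and the small bound accounts for the factor 2 of the capped term. Otherwise splitting the
  combined noise into the two query errors doubles \<open>5 / 4\<close> to
  \<open>5 / 2\<close>.\<close>

lemma adagrad_step_bound:
  fixes B :: "real^'n^'n" and M \<Omega> :: real and x y u v :: "real^'n"
  defines "Mp \<equiv> adagrad_rule B M \<Omega> x y u v"
  assumes B: "pos_def_mat B" and sm: "approx_smooth B \<delta> L f fbar gbar"
    and M: "M \<ge> 0" and \<Omega>: "\<Omega> > 0" and A: "A > 4 * L"
  shows "progress_gap B f fbar gbar x y u Mp + (Mp - M) * \<Omega> + lin_err f fbar gbar y x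
      + (v - gbar y) \<bullet> (y - x)
      \<le> 5 / 2 / (A - 4 * L) * ((dual_mnorm B (v - gbar y))\<^sup>2 + (dual_mnorm B (u - gbar x))\<^sup>2)
        + 6 * \<delta> + 2 * (max (min Mp A - M) 0 * \<Omega>)" (is "?l \<le> ?c * ?V + _ + _")
proof -
  have \<delta>: "\<delta> \<ge> 0"
    using sm by (simp add: approx_smooth_def)
  have c: "?c \<ge> 0"
    using A by simp
  have MMp: "M \<le> Mp"
    unfolding Mp_def by (rule adagrad_rule_ge[OF M \<Omega>])
  show ?thesis
  proof (cases "Mp \<le> A")
    case True
    have "0 \<le> ?c * ?V"
      using c by (intro mult_nonneg_nonneg) auto
    moreover have "max (min Mp A - M) 0 * \<Omega> = (Mp - M) * \<Omega>"
      using True MMp by simp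
    ultimately show ?thesis
      using adagrad_step_bound_small[OF B sm M \<Omega>, of x y u v, folded Mp_def] \<delta> by linarith
  next
    case False
    have "(dual_mnorm B ((v - gbar y) + (gbar x - u)))\<^sup>2
        \<le> (1 + 1) * (dual_mnorm B (v - gbar y))\<^sup>2 + (1 + 1 / 1) * (dual_mnorm B (gbar x - u))\<^sup>2"
      by (rule dual_mnorm_add_power2_le[OF B]) simp
    also have "dual_mnorm B (gbar x - u) = dual_mnorm B (u - gbar x)"
      using dual_mnorm_minus[OF B, of "u - gbar x"] by simp
    finally have "(dual_mnorm B ((v - gbar y) + (gbar x - u)))\<^sup>2 / (A - 4 * L) \<le> 2 * ?V / (A - 4 * L)"
      using A by (intro divide_right_mono) auto
    moreover have "5 / 4 * (2 * V / e) = 5 / 2 / e * V" for V e :: real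
      by (cases "e = 0") (simp_all add: field_simps)
    note this[of ?V "A - 4 * L"]
    moreover have "max (A - M) 0 * \<Omega> = max (min Mp A - M) 0 * \<Omega>" "0 \<le> max (A - M) 0 * \<Omega>"
      using False \<Omega> by auto
    moreover have "A < Mp"
      using False by simp
    note adagrad_step_bound_large[OF B sm M \<Omega> A this[unfolded Mp_def], folded Mp_def]
    ultimately show ?thesis
      by linarith
  qed
qed

section \<open>Independence, centred noise and extended expectations\<close>

text \<open>Independence is the product formula on measurable rectangles, and these determine a
  product of probability measures.\<close>

lemma indep_rvs_distr_pair:
  assumes "prob_space P" and "indep_rvs P N X K Y"
  shows "distr P (N \<Otimes>\<^sub>M K) (\<lambda>w. (X w, Y w)) = distr P N X \<Otimes>\<^sub>M distr P K Y"
proof -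
  interpret prob_space P by fact
  have X [measurable]: "X \<in> measurable P N" and Y [measurable]: "Y \<in> measurable P K"
    and ind: "indep_set (sets (vimage_algebra (space P) X N)) (sets (vimage_algebra (space P) Y K))"
    using assms(2) by (auto simp: indep_rvs_def)
  interpret NX: prob_space "distr P N X" by (rule prob_space_distr) fact
  interpret KY: prob_space "distr P K Y" by (rule prob_space_distr) fact
  show ?thesis
  proof (rule pair_measure_eqI[symmetric])
    fix A B assume "A \<in> sets (distr P N X)" "B \<in> sets (distr P K Y)"
    then have A [measurable]: "A \<in> sets N" and B [measurable]: "B \<in> sets K"
      by auto
    have "prob ((X -` A \<inter> space P) \<inter> (Y -` B \<inter> space P))
        = prob (X -` A \<inter> space P) * prob (Y -` B \<inter> space P)"
      by (rule indep_setD[OF ind]) (use A B in \<open>auto intro: in_vimage_algebra\<close>)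
    moreover have "(\<lambda>w. (X w, Y w)) -` (A \<times> B) \<inter> space P
        = (X -` A \<inter> space P) \<inter> (Y -` B \<inter> space P)"
      by auto
    ultimately show "emeasure (distr P N X) A * emeasure (distr P K Y) B
        = emeasure (distr P (N \<Otimes>\<^sub>M K) (\<lambda>w. (X w, Y w))) (A \<times> B)"
      by (simp add: emeasure_distr emeasure_eq_measure ennreal_mult'')
  qed (auto simp: NX.sigma_finite_measure_axioms KY.sigma_finite_measure_axioms)
qed

text \<open>Drops the first sample and keeps the next point. A preimage under \<open>Z\<close> is
  the preimage of a full-width rectangle under the pair, so the generated sigma-algebra only
  shrinks.\<close>

lemma indep_rvs_snd:
  assumes "prob_space P" and "indep_rvs P (N1 \<Otimes>\<^sub>M N2) (\<lambda>w. (X w, Z w)) K Y"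
  shows "indep_rvs P N2 Z K Y"
proof -
  interpret prob_space P by fact
  have XZ: "(\<lambda>w. (X w, Z w)) \<in> measurable P (N1 \<Otimes>\<^sub>M N2)" and Y: "Y \<in> measurable P K"
    and ind: "indep_set (sets (vimage_algebra (space P) (\<lambda>w. (X w, Z w)) (N1 \<Otimes>\<^sub>M N2)))
      (sets (vimage_algebra (space P) Y K))"
    using assms(2) by (auto simp: indep_rvs_def)
  have Z: "Z \<in> measurable P N2"
    using measurable_compose[OF XZ measurable_snd] by simp
  have "sets (vimage_algebra (space P) Z N2)
      \<subseteq> sets (vimage_algebra (space P) (\<lambda>w. (X w, Z w)) (N1 \<Otimes>\<^sub>M N2))"
  proof
    fix S assume "S \<in> sets (vimage_algebra (space P) Z N2)"
    then obtain A where A: "A \<in> sets N2" and S: "S = Z -` A \<inter> space P"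
      using measurable_space[OF Z] by (auto simp: sets_vimage_algebra2)
    have "S = (\<lambda>w. (X w, Z w)) -` (space N1 \<times> A) \<inter> space P"
      using measurable_space[OF XZ] by (auto simp: S space_pair_measure)
    then show "S \<in> sets (vimage_algebra (space P) (\<lambda>w. (X w, Z w)) (N1 \<Otimes>\<^sub>M N2))"
      using A by (auto intro!: in_vimage_algebra)
  qed
  then have "indep_set (sets (vimage_algebra (space P) Z N2)) (sets (vimage_algebra (space P) Y K))"
    using ind unfolding indep_set_def
    by (rule_tac indep_sets_mono_sets) (auto split: bool.split)
  with Z Y show ?thesis
    by (simp add: indep_rvs_def)
qed

text \<open>Neither \<open>X\<close> nor \<open>N\<close> is assumed integrable: when the negative part of \<open>X\<close> has finite
  expectation, so has the positive part of \<open>N\<close>, hence also its negative part.\<close>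

lemma ext_expectation_le_centered:
  assumes ext: "has_ext_expectation P X"
    and N [measurable]: "N \<in> borel_measurable P" and R [measurable]: "R \<in> borel_measurable P"
    and R_nonneg: "\<And>w. R w \<ge> 0"
    and le: "\<And>w. X w + N w \<le> R w"
    and centered: "(\<integral>\<^sup>+w. ennreal (N w) \<partial>P) = (\<integral>\<^sup>+w. ennreal (- N w) \<partial>P)"
  shows "ext_expectation P X \<le> enn2ereal (\<integral>\<^sup>+w. ennreal (R w) \<partial>P)"
proof -
  have X [measurable]: "X \<in> borel_measurable P"
    using ext by (simp add: has_ext_expectation_def)
  consider "(\<integral>\<^sup>+w. ennreal (R w) \<partial>P) = \<infinity>" | "(\<integral>\<^sup>+w. ennreal (- X w) \<partial>P) = \<infinity>"
    | "(\<integral>\<^sup>+w. ennreal (R w) \<partial>P) < \<infinity>" "(\<integral>\<^sup>+w. ennreal (- X w) \<partial>P) < \<infinity>"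
    by (metis infinity_ennreal_def top.not_eq_extremum)
  then show ?thesis
  proof cases
    case 1
    then show ?thesis by simp
  next
    case 2
    \<comment> \<open>Existence of the expectation excludes the difference of two infinities, so
      here its value is minus infinity.\<close>
    then have "(\<integral>\<^sup>+w. ennreal (X w) \<partial>P) < \<infinity>"
      using ext by (auto simp: has_ext_expectation_def)
    with 2 show ?thesis
      by (cases "\<integral>\<^sup>+w. ennreal (X w) \<partial>P") (auto simp: ext_expectation_def enn2ereal_ennreal)
  next
    case 3
    have add: "(\<integral>\<^sup>+w. ennreal (F w) \<partial>P) < \<infinity>"
      if "\<And>w. F w \<le> R w + G w" "(\<integral>\<^sup>+w. ennreal (G w) \<partial>P) < \<infinity>"
        "G \<in> borel_measurable P" for F G
    proof -
      have "ennreal (F w) \<le> ennreal (R w) + ennreal (G w)" for w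
      proof -
        \<comment> \<open>\<open>ennreal\<close> truncates negative values, so additivity requires
          the positive part of \<open>G w\<close> first.\<close>
        have "F w \<le> R w + max 0 (G w)"
          using that(1)[of w] by simp
        then have "ennreal (F w) \<le> ennreal (R w + max 0 (G w))"
          by (rule ennreal_leI)
        also have "\<dots> = ennreal (R w) + ennreal (G w)"
          using R_nonneg[of w] by (simp add: ennreal_plus ennreal_max_0)
        finally show ?thesis .
      qed
      then have "(\<integral>\<^sup>+w. ennreal (F w) \<partial>P) \<le> (\<integral>\<^sup>+w. ennreal (R w) + ennreal (G w) \<partial>P)"
        by (intro nn_integral_mono) simp
      also have "\<dots> = (\<integral>\<^sup>+w. ennreal (R w) \<partial>P) + (\<integral>\<^sup>+w. ennreal (G w) \<partial>P)"
        using that(3) by (intro nn_integral_add) auto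
      also have "\<dots> < \<infinity>"
        using 3 that(2) by simp
      finally show ?thesis .
    qed
    have "N w \<le> R w + - X w" "X w \<le> R w + - N w" for w
      using le[of w] by auto
    note bounds = this
    have Np: "(\<integral>\<^sup>+w. ennreal (N w) \<partial>P) < \<infinity>"
      by (rule add[OF bounds(1)]) (use 3 in auto)
    have Nm: "(\<integral>\<^sup>+w. ennreal (- N w) \<partial>P) < \<infinity>"
      using Np centered by simp
    have Xp: "(\<integral>\<^sup>+w. ennreal (X w) \<partial>P) < \<infinity>"
      by (rule add[OF bounds(2)]) (use Nm in auto)
    have int: "integrable P N" "integrable P X" "integrable P R"
      using Np Nm Xp 3 R_nonneg by (auto simp: real_integrable_def ennreal_neg less_top)
    have "(\<integral>w. N w \<partial>P) = 0"
      using centered by (simp add: real_lebesgue_integral_def[OF int(1)])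
    moreover have "(\<integral>w. X w \<partial>P) \<le> (\<integral>w. R w - N w \<partial>P)"
      using int le by (intro integral_mono) (auto simp: algebra_simps)
    ultimately have "(\<integral>w. X w \<partial>P) \<le> (\<integral>w. R w \<partial>P)"
      using int by simp
    moreover have "ext_expectation P X = ereal (\<integral>w. X w \<partial>P)"
      using Xp 3(2) unfolding ext_expectation_def real_lebesgue_integral_def[OF int(2)]
      by (cases "\<integral>\<^sup>+w. ennreal (X w) \<partial>P"; cases "\<integral>\<^sup>+w. ennreal (- X w) \<partial>P")
        (auto simp: enn2ereal_ennreal)
    moreover have "(\<integral>\<^sup>+w. ennreal (R w) \<partial>P) = ennreal (\<integral>w. R w \<partial>P)"
      using R_nonneg by (intro nn_integral_eq_integral int) auto
    ultimately show ?thesis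
      using R_nonneg by (simp add: enn2ereal_ennreal)
  qed
qed

text \<open>This form of mean zero can be integrated over the law of the next point even when the
  noise is not integrable jointly.\<close>

lemma nn_integral_centered:
  fixes h :: "'a \<Rightarrow> real"
  assumes "has_bochner_integral D h 0"
  shows "(\<integral>\<^sup>+s. ennreal (h s) \<partial>D) = (\<integral>\<^sup>+s. ennreal (- h s) \<partial>D)"
proof -
  have int: "integrable D h" and "(\<integral>s. h s \<partial>D) = 0"
    using assms by (auto simp: has_bochner_integral_iff)
  then have "enn2real (\<integral>\<^sup>+s. ennreal (h s) \<partial>D) = enn2real (\<integral>\<^sup>+s. ennreal (- h s) \<partial>D)"
    by (simp add: real_lebesgue_integral_def)
  moreover have "(\<integral>\<^sup>+s. ennreal (h s) \<partial>D) \<noteq> \<infinity>" "(\<integral>\<^sup>+s. ennreal (- h s) \<partial>D) \<noteq> \<infinity>"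
    using int by (auto simp: real_integrable_def)
  ultimately show ?thesis
    by (metis ennreal_enn2real infinity_ennreal_def less_top)
qed

text \<open>Conditioning on the next point: its joint law with the fresh sample is a product, and
  Tonelli's theorem integrates the sample first, without any integrability.\<close>

lemma nn_integral_oracle_query:
  assumes P: "prob_space P" and q: "oracle_queries P D xi xp xi'"
    and H [measurable]: "case_prod H \<in> borel_measurable (borel \<Otimes>\<^sub>M D)"
  shows "(\<integral>\<^sup>+w. H (xp w) (xi' w) \<partial>P) = (\<integral>\<^sup>+w. \<integral>\<^sup>+s. H (xp w) s \<partial>D \<partial>P)"
proof -
  interpret prob_space P by fact
  have [measurable]: "xp \<in> borel_measurable P" "xi' \<in> measurable P D"
    and D: "distr P D xi' = D" and "indep_rvs P (D \<Otimes>\<^sub>M borel) (\<lambda>w. (xi w, xp w)) D xi'"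
    using q by (auto simp: oracle_queries_def)
  note law = indep_rvs_distr_pair[OF P indep_rvs_snd[OF P this(4)], unfolded D]
  interpret D: prob_space D
    using prob_space_distr[of xi' D] D by simp
  have "(\<integral>\<^sup>+w. H (xp w) (xi' w) \<partial>P)
      = (\<integral>\<^sup>+z. case_prod H z \<partial>distr P (borel \<Otimes>\<^sub>M D) (\<lambda>w. (xp w, xi' w)))"
    by (subst nn_integral_distr) auto
  also have "\<dots> = (\<integral>\<^sup>+y. \<integral>\<^sup>+s. H y s \<partial>D \<partial>distr P borel xp)"
  proof -
    have "case_prod H \<in> borel_measurable (distr P borel xp \<Otimes>\<^sub>M D)"
      by simp
    then show ?thesis
      unfolding law by (simp add: D.nn_integral_fst[symmetric])
  qed
  also have "\<dots> = (\<integral>\<^sup>+w. \<integral>\<^sup>+s. H (xp w) s \<partial>D \<partial>P)"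
    by (rule nn_integral_distr) auto
  finally show ?thesis .
qed

text \<open>Unbiasedness presents \<open>gbar\<close> as a parameter integral of a jointly
  measurable function.\<close>

lemma unbiased_oracle_measurable:
  assumes "stoch_oracle D g" "unbiased_oracle D g gbar"
  shows "gbar \<in> borel_measurable borel"
proof -
  interpret prob_space D
    using assms(1) by (simp add: stoch_oracle_def)
  have [measurable]: "case_prod g \<in> borel_measurable (borel \<Otimes>\<^sub>M D)"
    using assms(1) by (simp add: stoch_oracle_def)
  have "gbar = (\<lambda>x. \<integral>s. g x s \<partial>D)"
    using assms(2) by (auto simp: unbiased_oracle_def has_bochner_integral_iff)
  then show ?thesis
    by simp
qed

section \<open>From the pointwise bound to expectations\<close>

theorem lemma20:
  fixes B :: "real^'n^'n" and \<psi> :: "real^'n \<Rightarrow> ereal"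
    and \<delta> L :: real
    and f fbar :: "real^'n \<Rightarrow> real" and gbar :: "real^'n \<Rightarrow> real^'n"
    and D :: "'s measure" and g :: "real^'n \<Rightarrow> 's \<Rightarrow> real^'n"
    and P :: "'w measure"
  assumes "pos_def_mat B"
    and "proper_closed_convex \<psi>"
    and "convex_on UNIV f"
    and "approx_smooth B \<delta> L f fbar gbar"
    and "stoch_oracle D g"
    and "unbiased_oracle D g gbar"
    and "prob_space P"
  shows "stepsize_requirement B \<psi> \<delta> L f fbar gbar D g P (adagrad_rule B) (5/2) 4 6 2"
proof -
  note B = assms(1) and sm = assms(4)
  interpret prob_space P by fact
  have g [measurable]: "case_prod g \<in> borel_measurable (borel \<Otimes>\<^sub>M D)"
    using assms(5) by (simp add: stoch_oracle_def)
  note [measurable] = unbiased_oracle_measurable[OF assms(5,6)] borel_measurable_dual_mnorm[OF B]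
  have \<delta>: "\<delta> \<ge> 0"
    using sm by (simp add: approx_smooth_def)
  {
    fix M \<Omega> :: real and x :: "real^'n" and xi xi' :: "'w \<Rightarrow> 's" and xp :: "'w \<Rightarrow> real^'n"
    assume M: "M \<ge> 0" and \<Omega>: "\<Omega> > 0" and q: "oracle_queries P D xi xp xi'"
    define Mp where "Mp = (\<lambda>w. adagrad_rule B M \<Omega> x (xp w) (g x (xi w)) (g (xp w) (xi' w)))"
    define lhs where "lhs = (\<lambda>w. progress_gap B f fbar gbar x (xp w) (g x (xi w)) (Mp w)
        + (Mp w - M) * \<Omega> + lin_err f fbar gbar (xp w) x)"
    have [measurable]: "xi \<in> measurable P D" "xp \<in> borel_measurable P" "xi' \<in> measurable P D"
      and xi: "distr P D xi = D"
      using q by (auto simp: oracle_queries_def)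
    have Mp_meas [measurable]: "Mp \<in> borel_measurable P"
      unfolding Mp_def adagrad_rule_def by measurable
    have Mp_ge: "Mp w \<ge> M" for w
      unfolding Mp_def by (rule adagrad_rule_ge[OF M \<Omega>])
    have "ext_expectation P lhs \<le> ereal (5 / 2 / (A - 4 * L)) *
          enn2ereal (\<integral>\<^sup>+w. oracle_var B D g gbar (xp w) + oracle_var B D g gbar x \<partial>P)
        + ereal (6 * \<delta>)
        + ereal 2 * enn2ereal (\<integral>\<^sup>+w. ennreal (max (min (Mp w) A - M) 0 * \<Omega>) \<partial>P)"
      if A: "A > 4 * L" and ext: "has_ext_expectation P lhs" for A
    proof -
      define c where "c = 5 / 2 / (A - 4 * L)"
      define a where "a = (\<lambda>y s. (dual_mnorm B (g y s - gbar y))\<^sup>2)"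
      define h where "h = (\<lambda>w. max (min (Mp w) A - M) 0 * \<Omega>)"
      define N where "N = (\<lambda>y s. (g y s - gbar y) \<bullet> (y - x))"
      define R where "R = (\<lambda>w. c * (a (xp w) (xi' w) + a x (xi w)) + 6 * \<delta> + 2 * h w)"
      have c: "c \<ge> 0"
        using A by (simp add: c_def)
      have h_nonneg: "h w \<ge> 0" for w
        using \<Omega> by (simp add: h_def)
      have a_nonneg: "a y s \<ge> 0" for y s
        by (simp add: a_def)
      have [measurable]: "case_prod a \<in> borel_measurable (borel \<Otimes>\<^sub>M D)"
        "case_prod N \<in> borel_measurable (borel \<Otimes>\<^sub>M D)" "h \<in> borel_measurable P"
        unfolding a_def N_def h_def by measurable
      \<comment> \<open>For a fixed \<open>y\<close> the direction \<open>y - x\<close> is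
        deterministic, so unbiasedness passes through the inner product.\<close>
      have N_D: "has_bochner_integral D (N y) 0" for y
      proof -
        interpret D: prob_space D
          using assms(5) by (simp add: stoch_oracle_def)
        have "has_bochner_integral D (g y) (gbar y)"
          using assms(6) by (simp add: unbiased_oracle_def)
        moreover have "has_bochner_integral D (\<lambda>s. gbar y) (gbar y)"
          by (simp add: has_bochner_integral_iff D.prob_space)
        ultimately have "has_bochner_integral D (\<lambda>s. g y s - gbar y) (gbar y - gbar y)"
          by (rule has_bochner_integral_diff)
        then show ?thesis
          using has_bochner_integral_inner_left[of "y - x" D "\<lambda>s. g y s - gbar y" 0]
          by (simp add: N_def)
      qed
      have "ext_expectation P lhs \<le> enn2ereal (\<integral>\<^sup>+w. ennreal (R w) \<partial>P)"
      proof (rule ext_expectation_le_centered[OF ext, where N = "\<lambda>w. N (xp w) (xi' w)"])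
        show "(\<lambda>w. N (xp w) (xi' w)) \<in> borel_measurable P" "R \<in> borel_measurable P"
          unfolding R_def by measurable
        show "R w \<ge> 0" for w
          using c \<delta> h_nonneg[of w] by (simp add: R_def a_nonneg)
        show "lhs w + N (xp w) (xi' w) \<le> R w" for w
          unfolding lhs_def N_def R_def a_def h_def c_def Mp_def
          by (rule adagrad_step_bound[OF B sm M \<Omega> A])
        \<comment> \<open>Conditioned on the next point, the positive and the negative part of the
          noise have equal integrals by \<open>N_D\<close>.\<close>
        show "(\<integral>\<^sup>+w. ennreal (N (xp w) (xi' w)) \<partial>P) = (\<integral>\<^sup>+w. ennreal (- N (xp w) (xi' w)) \<partial>P)"
          using nn_integral_oracle_query[OF assms(7) q, of "\<lambda>y s. ennreal (N y s)"]
            nn_integral_oracle_query[OF assms(7) q, of "\<lambda>y s. ennreal (- N y s)"]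
          by (simp add: nn_integral_centered[OF N_D])
      qed
      also have "(\<integral>\<^sup>+w. ennreal (R w) \<partial>P)
          = (\<integral>\<^sup>+w. ennreal c * (ennreal (a (xp w) (xi' w)) + ennreal (a x (xi w)))
              + ennreal (6 * \<delta>) + ennreal 2 * ennreal (h w) \<partial>P)"
        using c \<delta> h_nonneg a_nonneg
        by (intro nn_integral_cong)
          (simp add: R_def ennreal_mult)
      also have "\<dots> = ennreal c * ((\<integral>\<^sup>+w. ennreal (a (xp w) (xi' w)) \<partial>P) + (\<integral>\<^sup>+w. ennreal (a x (xi w)) \<partial>P))
          + ennreal (6 * \<delta>) + ennreal 2 * (\<integral>\<^sup>+w. ennreal (h w) \<partial>P)"
        by (simp add: nn_integral_add nn_integral_cmult emeasure_space_1)
      also have "(\<integral>\<^sup>+w. ennreal (a (xp w) (xi' w)) \<partial>P) = (\<integral>\<^sup>+w. oracle_var B D g gbar (xp w) \<partial>P)"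
        unfolding oracle_var_def
        using nn_integral_oracle_query[OF assms(7) q, of "\<lambda>y s. ennreal (a y s)"]
        by (simp add: a_def)
      \<comment> \<open>The point \<open>x\<close> is deterministic, so the law of \<open>xi\<close>
        suffices, however \<open>xp\<close> depends on it.\<close>
      also have "(\<integral>\<^sup>+w. ennreal (a x (xi w)) \<partial>P) = oracle_var B D g gbar x"
        unfolding oracle_var_def
        using nn_integral_distr[of xi P D "\<lambda>s. ennreal (a x s)"]
        by (simp add: xi a_def)
      \<comment> \<open>The variance at \<open>x\<close> is constant and \<open>P\<close> has total
        mass 1, so it may be moved under the integral, even if infinite.\<close>
      also have "(\<integral>\<^sup>+w. oracle_var B D g gbar (xp w) \<partial>P) + oracle_var B D g gbar x
          = (\<integral>\<^sup>+w. oracle_var B D g gbar (xp w) + oracle_var B D g gbar x \<partial>P)"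
      proof -
        interpret D: prob_space D
          using assms(5) by (simp add: stoch_oracle_def)
        have [measurable]: "oracle_var B D g gbar \<in> borel_measurable borel"
          unfolding oracle_var_def[abs_def] by measurable
        show ?thesis
          by (simp add: nn_integral_add emeasure_space_1)
      qed
      finally show ?thesis
        using c \<delta> by (simp add: plus_ennreal.rep_eq times_ennreal.rep_eq enn2ereal_ennreal c_def h_def
            flip: ennreal_numeral)
    qed
    note Mp_meas Mp_ge this
  }
  then show ?thesis
    unfolding stepsize_requirement_def Let_def by auto
qed

end
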